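(* Let $m\ge 1$ be an integer, let $n=2m+1$, let $M_n$ be the $n\times n$ odd magic square generated by the Siamese method, and let $$\Lambda=\left\{\lambda_j=\frac{n^2}{2\sin(j\pi/n)} : j\in\{\pm1,\pm2,\ldots,\pm m\}\right\}.$$ Then the set of non-trivial eigenvalues of $M_n$ is $\frac1n$-approximated by $\Lambda$.
   Context: For odd $n$, the magic square $M_n$ generated by the Siamese method (as implemented in MATLAB's magic(n)) is the $n\times n$ matrix with entries, for $i,j\in\{1,\ldots,n\}$, $$M_n(i,j)=n\left(\left(i+j+\tfrac{n-3}{2}\right)\bmod n\right)+\left((i+2j-2)\bmod n\right)+1,$$ where $x \bmod n$ denotes the residue in $\{0,1,\ldots,n-1\}$. The all-ones vector is an eigenvector of $M_n$ with eigenvalue the magic sum $\mu_0=\frac{n(n^2+1)}{2}$; this pair is called the trivial eigenpair, and $\mu_0$ is an eigenvalue of multiplicity one. The non-trivial eigenvalues of $M_n$ are its other $n-1$ eigenvalues (with multiplicity). A set $P$ is said to be $\epsilon$-approximated by a set $Q$ if for each $p\in P$ there exists $q\in Q$ such that $\frac{|p-q|}{|q|}\le\epsilon$. *)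

theory Defs
  imports Complex_Main "Jordan_Normal_Form.Char_Poly"
begin

(* Rows and columns are numbered 1..n here; the division by 2 is exact because n is odd. *)
definition siamese_entry :: "int \<Rightarrow> int \<Rightarrow> int \<Rightarrow> int" where
  "siamese_entry n i j = n * ((i + j + (n - 3) div 2) mod n) + ((i + 2 * j - 2) mod n) + 1"

(* Jordan_Normal_Form matrices are indexed from 0, hence the shift. *)
definition siamese :: "nat \<Rightarrow> complex mat" where
  "siamese n = mat n n (\<lambda>(i, j). of_int (siamese_entry (int n) (int i + 1) (int j + 1)))"

definition magic_sum :: "nat \<Rightarrow> complex" where
  "magic_sum n = of_nat n * (of_nat n ^ 2 + 1) / 2"

(* The eigenvalues with algebraic multiplicity, with one copy of the trivial one removed. *)
definition nontrivial_eigenvalues :: "nat \<Rightarrow> complex multiset" where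
  "nontrivial_eigenvalues n = proots (char_poly (siamese n)) - {#magic_sum n#}"

(* The condition q \<noteq> 0 excludes points at which the relative error is undefined
   (in HOL it would be 0). *)
definition approximated_by :: "real \<Rightarrow> complex set \<Rightarrow> complex set \<Rightarrow> bool" where
  "approximated_by \<epsilon> P Q \<longleftrightarrow> (\<forall>p\<in>P. \<exists>q\<in>Q. q \<noteq> 0 \<and> cmod (p - q) / cmod q \<le> \<epsilon>)"

end

theory Submission
  imports Defs
begin

text \<open>
Let \<open>n = 2 * m + 1\<close>. The magic square is \<open>n A + B + J\<close>, where \<open>J\<close> is the matrix of ones and \<open>A\<close>, \<open>B\<close>
consist of the two base \<open>n\<close> digits: their entries are sawtooth functions of \<open>i + j\<close> and of
\<open>i + 2 * j\<close> modulo \<open>n\<close>. A nontrivial eigenvalue has an eigenvector \<open>x\<close> orthogonal to the vector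
of ones (\<open>eigenvector_of_complementary_root\<close>), and \<open>J\<close> vanishes there.

On that subspace \<open>A\<close> is real symmetric, and in the Fourier basis it exchanges the frequencies \<open>k\<close>
and \<open>-k\<close> with a weight of modulus \<open>n / (2 * \<bar>sin (k * pi / n)\<bar>)\<close>; hence the eigenvalues
of \<open>n A\<close> are exactly the approximating points. The matrix \<open>B\<close> is not small compared with the gaps
of that spectrum, but it carries the same Fourier weights: both digits are the same sawtooth up
to a shift. Consequently \<open>A\<^sup>-\<^sup>1 B\<close> is unitary. From \<open>n A x + B x = \<mu> x\<close> one gets
\<open>(n I - \<mu> A\<^sup>-\<^sup>1) x = - A\<^sup>-\<^sup>1 B x\<close>, whose right-hand side has the norm of \<open>x\<close>. The
operator on the left is normal with eigenvalues \<open>n * (\<lambda> - \<mu>) / \<lambda>\<close>, for \<open>\<lambda>\<close> an eigenvalue of \<open>n A\<close>, so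
one of these has modulus at most 1. This is the claimed relative error.

The proof below carries this out on Fourier coefficients. The eigenvalue equation with the weights
cleared is \<open>shifted_dft_eigenvector\<close>, where the unitary operator has become the permutation
\<open>k \<mapsto> -2k\<close> of the frequencies, and \<open>eigenvalue_near_frequency\<close> compares the norms of its two
sides.
\<close>

section \<open>Roots of a characteristic polynomial besides a constant column sum\<close>

text \<open>Adding all rows of \<open>X I - A\<close> to the first one turns it into \<open>X - c\<close> times the row of ones, so the
characteristic polynomial is \<open>X - c\<close> times the determinant of the matrix whose first row is
the row of ones. A root of that determinant gives a kernel vector: its first entry equation says
that the entries of the vector sum to 0, the others are all eigenvalue equations but one,
which follows from them. This covers also the case that \<open>c\<close> itself is a repeated root.\<close>
lemma eigenvector_of_complementary_root:
  fixes A :: "'a::field mat"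
  assumes A: "A \<in> carrier_mat n n" and n: "n > 0"
    and col: "\<And>j. j < n \<Longrightarrow> (\<Sum>i<n. A $$ (i, j)) = c"
    and mu: "\<mu> \<in># proots (char_poly A) - {#c#}"
  shows "\<exists>x. (\<Sum>j<n. x j) = 0 \<and> (\<exists>j<n. x j \<noteq> 0) \<and>
    (\<forall>i<n. (\<Sum>j<n. A $$ (i, j) * x j) = \<mu> * x i)"
proof -
  define C where "C = char_poly_matrix A"
  define N where "N = mat n n (\<lambda>(i, j). if i = 0 then 1 else C $$ (i, j))"
  define E :: "'a poly mat" where "E = mat n n (\<lambda>(i, j). if i = 0 \<or> i = j then 1 else 0)"
  have carr: "C \<in> carrier_mat n n" "N \<in> carrier_mat n n" "E \<in> carrier_mat n n"
    using A by (auto simp: C_def N_def E_def)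
  have C: "C $$ (i, j) = (if i = j then [:0, 1:] else 0) - [:A $$ (i, j):]" if "i < n" "j < n" for i j
    using that A by (auto simp: C_def char_poly_matrix_def)
  have const: "(\<Sum>i\<in>S. [:f i:]) = [:\<Sum>i\<in>S. f i:]" for f :: "nat \<Rightarrow> 'a" and S
    by (induction S rule: infinite_finite_induct) auto
  have colC: "(\<Sum>i<n. C $$ (i, j)) = [:-c, 1:]" if "j < n" for j
  proof -
    have "(\<Sum>i<n. C $$ (i, j)) = (\<Sum>i<n. (if i = j then [:0, 1:] else 0) - [:A $$ (i, j):])"
      using that by (intro sum.cong) (auto simp: C)
    also have "\<dots> = [:-c, 1:]"
      using that by (simp add: sum_subtractf const col)
    finally show ?thesis .
  qed
  \<comment> \<open>Multiplication by \<open>E\<close> adds all other rows to row 0.\<close>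
  have "E * C = multrow 0 [:-c, 1:] N"
  proof (rule eq_matI)
    fix i j assume "i < dim_row (multrow 0 [:-c, 1:] N)" "j < dim_col (multrow 0 [:-c, 1:] N)"
    hence ij: "i < n" "j < n" using carr by auto
    have "(E * C) $$ (i, j) = (\<Sum>k<n. (if i = 0 \<or> i = k then 1 else 0) * C $$ (k, j))"
      using ij carr by (simp add: scalar_prod_def E_def lessThan_atLeast0)
    also have "\<dots> = (if i = 0 then [:-c, 1:] else C $$ (i, j))"
      using ij colC[of j] by (auto simp: if_distrib[of "\<lambda>x. x * _"] cong: if_cong)
    also have "\<dots> = multrow 0 [:-c, 1:] N $$ (i, j)"
      using ij carr by (auto simp: N_def)
    finally show "(E * C) $$ (i, j) = multrow 0 [:-c, 1:] N $$ (i, j)" .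
  qed (use carr in auto)
  moreover have "det E = 1"
  proof -
    have "det E = prod_list (diag_mat E)"
      using carr by (intro det_upper_triangular) (auto simp: upper_triangular_def E_def)
    also have "\<dots> = 1"
      using carr by (intro prod_list_neutral) (auto simp: diag_mat_def E_def)
    finally show ?thesis .
  qed
  ultimately have factor: "char_poly A = [:-c, 1:] * det N"
    using det_mult[of E n C] det_multrow[of 0 n N "[:-c, 1:]"] carr n
    by (simp add: char_poly_def C_def)
  have "char_poly A \<noteq> 0"
    using degree_monic_char_poly[OF A] by auto
  hence "det N \<noteq> 0" using factor by auto
  hence "\<mu> \<in># proots (det N)"
    using mu unfolding factor by (subst (asm) proots_mult) auto
  hence root: "poly (det N) \<mu> = 0" using \<open>det N \<noteq> 0\<close> by simp
  define B where "B = map_mat (\<lambda>p. poly p \<mu>) N"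
  have B: "B \<in> carrier_mat n n" using carr by (auto simp: B_def)
  have "det B = 0" using root
    by (simp add: B_def comm_ring_hom.hom_det[OF poly_hom.comm_ring_hom_axioms])
  then obtain v where v: "v \<in> carrier_vec n" "v \<noteq> 0\<^sub>v n" "B *\<^sub>v v = 0\<^sub>v n"
    using det_0_iff_vec_prod_zero[OF B] by auto
  define x where "x = (\<lambda>j. v $ j)"
  have Bx: "(\<Sum>j<n. B $$ (i, j) * x j) = 0" if "i < n" for i
  proof -
    have "(B *\<^sub>v v) $ i = (\<Sum>j<n. B $$ (i, j) * x j)"
      using that B v(1) by (simp add: scalar_prod_def x_def lessThan_atLeast0)
    thus ?thesis using v(3) that by simp
  qed
  have sum0: "(\<Sum>j<n. x j) = 0"
    using Bx[OF n] n carr by (simp add: B_def N_def)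
  define r where "r = (\<lambda>i. \<mu> * x i - (\<Sum>j<n. A $$ (i, j) * x j))"
  have r: "r i = 0" if "i < n" "i \<noteq> 0" for i
  proof -
    have "(\<Sum>j<n. B $$ (i, j) * x j) = (\<Sum>j<n. (if i = j then \<mu> * x j else 0) - A $$ (i, j) * x j)"
      using that carr by (intro sum.cong) (auto simp: B_def N_def C algebra_simps)
    also have "\<dots> = r i" using that by (simp add: sum_subtractf r_def)
    finally show ?thesis using Bx that by simp
  qed
  \<comment> \<open>Row 0 was overwritten by ones, but the residuals of all rows sum to
      \<open>(\<mu> - c) * (\<Sum>j<n. x j) = 0\<close>.\<close>
  have "(\<Sum>i<n. r i) = \<mu> * (\<Sum>i<n. x i) - (\<Sum>j<n. (\<Sum>i<n. A $$ (i, j)) * x j)"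
    unfolding r_def sum_subtractf sum_distrib_left sum_distrib_right
    by (subst (2) sum.swap) simp
  also have "(\<Sum>j<n. (\<Sum>i<n. A $$ (i, j)) * x j) = c * (\<Sum>j<n. x j)"
    unfolding sum_distrib_left by (intro sum.cong) (auto simp: col)
  finally have "(\<Sum>i<n. r i) = 0" using sum0 by simp
  moreover have "(\<Sum>i<n. r i) = r 0 + (\<Sum>i\<in>{..<n} - {0}. r i)"
    using n by (intro sum.remove) auto
  ultimately have "r 0 = 0" using r by simp
  hence "r i = 0" if "i < n" for i using r that by (cases "i = 0") auto
  hence eig: "(\<Sum>j<n. A $$ (i, j) * x j) = \<mu> * x i" if "i < n" for i
    using that by (simp add: r_def)
  have "\<exists>j<n. x j \<noteq> 0" using v(1,2) by (auto simp: x_def intro!: eq_vecI)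
  with sum0 eig show ?thesis by blast
qed

section \<open>Roots of unity and the transform of the sawtooth\<close>

definition unity :: "int \<Rightarrow> int \<Rightarrow> complex" where
  "unity N k = cis (2 * pi * of_int k / of_int N)"

lemma unity_0 [simp]: "unity N 0 = 1"
  by (simp add: unity_def)

lemma unity_add: "unity N (k + l) = unity N k * unity N l"
  by (simp add: unity_def cis_mult add_divide_distrib ring_distribs)

lemma unity_neq_0 [simp]: "unity N k \<noteq> 0"
  by (simp add: unity_def)

lemma unity_eq_1_iff:
  assumes "N > 0"
  shows "unity N k = 1 \<longleftrightarrow> N dvd k"
proof
  assume "unity N k = 1"
  hence "cos (2 * pi * of_int k / of_int N) = 1"
    by (simp add: unity_def complex_eq_iff)
  then obtain l :: int where "2 * pi * of_int k / of_int N = of_int l * 2 * pi"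
    by (auto simp: cos_one_2pi_int)
  hence "real_of_int k = of_int (l * N)"
    using assms by (simp add: field_simps)
  thus "N dvd k" by (metis of_int_eq_iff dvd_triv_right)
next
  assume "N dvd k"
  then obtain l where "k = N * l" by blast
  hence "2 * pi * of_int k / of_int N = 2 * pi * of_int l"
    using assms by simp
  thus "unity N k = 1"
    unfolding unity_def by (simp only:) (simp add: complex_eq_iff sin_times_pi_eq_0)
qed

lemma unity_cong:
  assumes "N > 0" "N dvd k - l"
  shows "unity N k = unity N l"
  using unity_add[of N l "k - l"] unity_eq_1_iff[OF assms(1), of "k - l"] assms(2) by simp

text \<open>Summing over all residues is invariant under every invertible affine change of variable. All
reindexings below are instances: shifts of the row index, and \<open>k \<mapsto> -k\<close> and \<open>k \<mapsto> -2k\<close> on the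
frequencies, the last of which is a permutation because the order is odd.\<close>
lemma sum_affine_residues:
  fixes f :: "int \<Rightarrow> 'a::comm_monoid_add"
  assumes N: "N > 0" and u: "coprime u N" and f: "\<And>x. f (x mod N) = f x"
  shows "(\<Sum>x\<in>{0..<N}. f (u * x + c)) = (\<Sum>x\<in>{0..<N}. f x)"
proof -
  let ?g = "\<lambda>x. (u * x + c) mod N"
  have "inj_on ?g {0..<N}"
  proof (rule inj_onI)
    fix x y assume xy: "x \<in> {0..<N}" "y \<in> {0..<N}" "?g x = ?g y"
    hence "N dvd u * (x - y)"
      by (auto simp: mod_eq_dvd_iff algebra_simps)
    hence "N dvd x - y"
      using u by (simp add: coprime_dvd_mult_right_iff coprime_commute)
    hence "x mod N = y mod N" by (simp add: mod_eq_dvd_iff)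
    thus "x = y" using xy by simp
  qed
  moreover have "?g ` {0..<N} \<subseteq> {0..<N}" using N by auto
  ultimately have "bij_betw ?g {0..<N} {0..<N}"
    by (simp add: bij_betw_def endo_inj_surj)
  hence "(\<Sum>x\<in>{0..<N}. f (?g x)) = (\<Sum>x\<in>{0..<N}. f x)"
    by (rule sum.reindex_bij_betw)
  thus ?thesis by (simp add: f)
qed

lemma unity_periodic:
  assumes "N > 0"
  shows "unity N (k * (x mod N) + l) = unity N (k * x + l)"
proof (rule unity_cong[OF assms])
  have "N dvd k * (x mod N - x)" by (intro dvd_mult) (simp flip: mod_eq_dvd_iff)
  thus "N dvd k * (x mod N) + l - (k * x + l)" by (simp add: algebra_simps)
qed

lemma sum_unity:
  assumes "N > 0"
  shows "(\<Sum>s\<in>{0..<N}. unity N (k * s)) = (if N dvd k then of_int N else 0)"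
proof (cases "N dvd k")
  case True
  hence "unity N (k * s) = 1" for s
    using assms by (simp add: unity_eq_1_iff)
  thus ?thesis using True assms by simp
next
  case False
  let ?S = "\<Sum>s\<in>{0..<N}. unity N (k * s)"
  have "?S = (\<Sum>s\<in>{0..<N}. unity N (k * (1 * s + 1)))"
    using unity_periodic[OF assms, of k _ 0]
    by (intro sum_affine_residues[OF assms, symmetric]) auto
  also have "\<dots> = unity N k * ?S"
    by (simp add: ring_distribs unity_add sum_distrib_left mult.commute)
  finally have "(unity N k - 1) * ?S = 0" by (simp add: algebra_simps)
  thus ?thesis using False unity_eq_1_iff[OF assms] by simp
qed

text \<open>The sawtooth \<open>s \<mapsto> s mod N\<close> increases by 1 at each step except for a drop by \<open>N\<close> when it
wraps around. The constant step has vanishing transform at a nonzero frequency, so only the drop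
is seen.\<close>
lemma sawtooth_transform:
  assumes N: "N > 0" and k: "\<not> N dvd k"
  shows "(unity N k - 1) * (\<Sum>s\<in>{0..<N}. of_int s * unity N (k * s)) = of_int N"
proof -
  let ?D = "\<Sum>s\<in>{0..<N}. of_int s * unity N (k * s)"
  let ?f = "\<lambda>s. of_int (s mod N) * unity N (k * s)"
  have "?D = (\<Sum>s\<in>{0..<N}. ?f s)" by (intro sum.cong) auto
  also have "\<dots> = (\<Sum>s\<in>{0..<N}. ?f (1 * s + 1))"
    using unity_periodic[OF N, of k _ 0]
    by (intro sum_affine_residues[OF N, symmetric]) auto
  also have "\<dots> = (\<Sum>s\<in>{0..<N}. unity N k * (of_int s * unity N (k * s) + unity N (k * s)
                       - (if s = N - 1 then of_int N * unity N (k * s) else 0)))"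
  proof (intro sum.cong refl)
    fix s assume s: "s \<in> {0..<N}"
    have "(s + 1) mod N = s + 1 - (if s = N - 1 then N else 0)" using s by auto
    thus "?f (1 * s + 1) = unity N k * (of_int s * unity N (k * s) + unity N (k * s)
                       - (if s = N - 1 then of_int N * unity N (k * s) else 0))"
      by (simp add: ring_distribs unity_add)
  qed
  also have "\<dots> = unity N k * (?D - of_int N * unity N (k * (N - 1)))"
    using N k by (simp add: sum_unity sum.distrib sum_subtractf flip: sum_distrib_left)
  also have "\<dots> = unity N k * ?D - of_int N * unity N (k * N)"
    by (simp add: ring_distribs flip: unity_add)
  also have "unity N (k * N) = 1" using N by (simp add: unity_eq_1_iff)
  finally show ?thesis by (simp add: algebra_simps)
qed

lemma shifted_sawtooth_transform:
  assumes N: "N > 0" and k: "\<not> N dvd k"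
  shows "(unity N k - 1) * (\<Sum>i\<in>{0..<N}. unity N (k * (i + h)) * of_int ((i + c) mod N))
         = of_int N * unity N (k * (h - c))"
proof -
  let ?f = "\<lambda>s. unity N (k * (h - c)) * (of_int (s mod N) * unity N (k * s))"
  have "(\<Sum>i\<in>{0..<N}. unity N (k * (i + h)) * of_int ((i + c) mod N)) = (\<Sum>i\<in>{0..<N}. ?f (1 * i + c))"
    by (intro sum.cong refl) (simp add: mult_ac flip: unity_add, simp add: algebra_simps flip: unity_add)
  also have "\<dots> = (\<Sum>i\<in>{0..<N}. ?f i)"
    using unity_periodic[OF N, of k _ 0] by (intro sum_affine_residues[OF N]) auto
  also have "\<dots> = unity N (k * (h - c)) * (\<Sum>s\<in>{0..<N}. of_int s * unity N (k * s))"
    unfolding sum_distrib_left by (intro sum.cong) auto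
  finally show ?thesis
    using sawtooth_transform[OF N k] by (simp only: mult.left_commute) simp
qed

section \<open>The eigenvalue equation on the Fourier side\<close>

text \<open>The discrete Fourier transform with origin \<open>-h\<close>. With \<open>h = (N + 1) / 2\<close>, the inverse of 2
modulo \<open>N\<close>, the factor \<open>unity N (k * h)\<close> is a square root of \<open>unity N k\<close>; this choice makes
all phases disappear from the transformed eigenvalue equation.\<close>
definition shifted_dft :: "int \<Rightarrow> int \<Rightarrow> (int \<Rightarrow> complex) \<Rightarrow> int \<Rightarrow> complex" where
  "shifted_dft N h x k = (\<Sum>j\<in>{0..<N}. unity N (k * (j + h)) * x j)"

lemma shifted_dft_periodic:
  assumes N: "N > 0"
  shows "shifted_dft N h x (u * (k mod N)) = shifted_dft N h x (u * k)"
proof -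
  have "unity N (u * (k mod N) * (j + h)) = unity N (u * k * (j + h))" for j
    using unity_periodic[OF N, of "u * (j + h)" k 0] by (simp add: mult_ac)
  thus ?thesis by (simp add: shifted_dft_def)
qed

lemma shifted_dft_nonzero:
  assumes N: "N > 0" and l: "l \<in> {0..<N}" "x l \<noteq> 0"
  obtains k where "k \<in> {0..<N}" "shifted_dft N h x k \<noteq> 0"
proof -
  \<comment> \<open>Fourier inversion recovers \<open>N * x l\<close> from the transform.\<close>
  have "(\<Sum>k\<in>{0..<N}. unity N (k * (- (l + h))) * shifted_dft N h x k)
      = (\<Sum>k\<in>{0..<N}. \<Sum>j\<in>{0..<N}. x j * unity N ((j - l) * k))"
    unfolding shifted_dft_def sum_distrib_left
    by (intro sum.cong refl) (simp add: mult_ac flip: unity_add, simp add: algebra_simps flip: unity_add)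
  also have "\<dots> = (\<Sum>j\<in>{0..<N}. x j * (if N dvd j - l then of_int N else 0))"
    by (subst sum.swap) (simp add: sum_unity[OF N] flip: sum_distrib_left)
  also have "\<dots> = (\<Sum>j\<in>{0..<N}. if j = l then x l * of_int N else 0)"
  proof (intro sum.cong refl)
    fix j assume j: "j \<in> {0..<N}"
    have "N dvd j - l \<longleftrightarrow> j = l"
      using j l(1) by (simp flip: mod_eq_dvd_iff)
    thus "x j * (if N dvd j - l then of_int N else 0) = (if j = l then x l * of_int N else 0)" by simp
  qed
  also have "\<dots> \<noteq> 0" using l N by simp
  finally show ?thesis using that by (metis (no_types, lifting) mult_zero_right sum.neutral)
qed

text \<open>In the Fourier basis the two sawtooth parts of the magic square act on frequencies as \<open>k \<mapsto> -k\<close>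
and \<open>k \<mapsto> -2k\<close>, because their column \<open>j\<close> is a sawtooth shifted by \<open>j\<close> and \<open>2 * j\<close>, and the constant part
acts only at frequency 0. Both sawtooth multipliers are proportional to
\<open>1 / (unity N k - 1)\<close>, so after clearing this common denominator the second part becomes
\<open>N\<close> times a permutation of the frequencies.\<close>
lemma shifted_dft_eigenvector:
  fixes x :: "int \<Rightarrow> complex"
  assumes N: "N > 0" and h: "2 * h = N + 1"
    and sum0: "(\<Sum>j\<in>{0..<N}. x j) = 0"
    and eig: "\<And>i. i \<in> {0..<N} \<Longrightarrow>
      (\<Sum>j\<in>{0..<N}. of_int (N * ((i + j + h) mod N) + (i + 2 * j + 1) mod N + 1) * x j) = \<mu> * x i"
  shows "(unity N (k * h) - unity N (- (k * h))) * \<mu> * shifted_dft N h x k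
         = of_int N ^ 2 * shifted_dft N h x (- k) + of_int N * shifted_dft N h x (- 2 * k)"
proof (cases "N dvd k")
  case True
  hence "unity N (u * k * (j + h)) = 1" for u j
    using N by (simp add: unity_eq_1_iff)
  hence "shifted_dft N h x (u * k) = 0" for u
    using sum0 by (simp add: shifted_dft_def)
  from this[of 1] this[of "-1"] this[of "-2"] show ?thesis by simp
next
  case False
  let ?e = "unity N"
  let ?M = "\<lambda>i j. of_int (N * ((i + j + h) mod N) + (i + 2 * j + 1) mod N + 1) :: complex"
  have 1: "(?e k - 1) * (\<Sum>i\<in>{0..<N}. ?e (k * (i + h)) * ?M i j)
      = of_int N ^ 2 * ?e (k * (- j)) + of_int N * ?e (k * (h - (2 * j + 1)))" for j
  proof -
    have "(\<Sum>i\<in>{0..<N}. ?e (k * (i + h))) = ?e (k * h) * (\<Sum>i\<in>{0..<N}. ?e (k * i))"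
      unfolding sum_distrib_left by (simp add: ring_distribs unity_add mult_ac)
    hence 0: "(\<Sum>i\<in>{0..<N}. ?e (k * (i + h))) = 0"
      using sum_unity[OF N, of k] False by simp
    have "(\<Sum>i\<in>{0..<N}. ?e (k * (i + h)) * ?M i j)
        = of_int N * (\<Sum>i\<in>{0..<N}. ?e (k * (i + h)) * of_int ((i + (j + h)) mod N))
        + (\<Sum>i\<in>{0..<N}. ?e (k * (i + h)) * of_int ((i + (2 * j + 1)) mod N))
        + (\<Sum>i\<in>{0..<N}. ?e (k * (i + h)))"
      unfolding sum_distrib_left sum.distrib[symmetric]
      by (intro sum.cong refl) (simp add: algebra_simps)
    also have "(?e k - 1) * \<dots> =
        of_int N * (of_int N * ?e (k * (h - (j + h)))) + of_int N * ?e (k * (h - (2 * j + 1)))"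
      unfolding 0 distrib_left[of "?e k - 1"] mult.left_commute[of "?e k - 1" "of_int N"]
        shifted_sawtooth_transform[OF N False] by (simp del: mult_eq_0_iff mult_cancel_left)
    finally show ?thesis by (simp add: power2_eq_square)
  qed
  have "(?e k - 1) * (\<mu> * shifted_dft N h x k) =
      (?e k - 1) * (\<Sum>i\<in>{0..<N}. ?e (k * (i + h)) * (\<Sum>j\<in>{0..<N}. ?M i j * x j))"
    unfolding shifted_dft_def sum_distrib_left[of \<mu>]
    by (intro arg_cong[where f = "(*) (?e k - 1)"] sum.cong refl) (simp only: eig mult.left_commute)
  also have "\<dots> = (\<Sum>j\<in>{0..<N}. ((?e k - 1) * (\<Sum>i\<in>{0..<N}. ?e (k * (i + h)) * ?M i j)) * x j)"
    unfolding sum_distrib_left sum_distrib_right by (subst sum.swap) (simp only: mult_ac)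
  also have "\<dots> = (\<Sum>j\<in>{0..<N}. ?e (k * h) * (of_int N ^ 2 * (?e ((- k) * (j + h)) * x j)
                     + of_int N * (?e ((- 2 * k) * (j + h)) * x j)))"
  proof (intro sum.cong refl)
    fix j
    have "?e (k * (- j)) = ?e (k * h) * ?e ((- k) * (j + h))"
      by (simp add: algebra_simps flip: unity_add)
    moreover have "?e (k * (h - (2 * j + 1))) = ?e (k * h) * ?e ((- 2 * k) * (j + h))"
    proof -
      have "k * (h - (2 * j + 1)) - (k * h + (- 2 * k) * (j + h)) = k * (2 * h - 1)"
        by (simp add: algebra_simps)
      also have "\<dots> = k * N" using h by simp
      finally show ?thesis unfolding unity_add[symmetric]
        by (intro unity_cong[OF N]) simp
    qed
    ultimately show "((?e k - 1) * (\<Sum>i\<in>{0..<N}. ?e (k * (i + h)) * ?M i j)) * x j =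
        ?e (k * h) * (of_int N ^ 2 * (?e ((- k) * (j + h)) * x j)
                     + of_int N * (?e ((- 2 * k) * (j + h)) * x j))"
      unfolding 1 by (simp add: algebra_simps)
  qed
  also have "\<dots> = ?e (k * h) * (of_int N ^ 2 * shifted_dft N h x (- k) + of_int N * shifted_dft N h x (- 2 * k))"
    unfolding shifted_dft_def by (simp only: sum.distrib flip: sum_distrib_left)
  also have "?e k - 1 = ?e (k * h) * (?e (k * h) - ?e (- (k * h)))"
  proof -
    have "k * h + k * h - k = k * (2 * h - 1)" by (simp add: algebra_simps)
    hence "k * h + k * h - k = k * N" using h by simp
    hence "?e (k * h + k * h) = ?e k" by (intro unity_cong[OF N]) simp
    thus ?thesis by (simp add: right_diff_distrib flip: unity_add)
  qed
  finally have "?e (k * h) * ((?e (k * h) - ?e (- (k * h))) * \<mu> * shifted_dft N h x k)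
    = ?e (k * h) * (of_int N ^ 2 * shifted_dft N h x (- k) + of_int N * shifted_dft N h x (- 2 * k))"
    by (simp only: mult_ac)
  thus ?thesis by (simp del: mult_minus_left)
qed

text \<open>The matrix with rows \<open>(a, -b)\<close> and \<open>(b, a)\<close> is normal with eigenvectors \<open>(1, \<plusminus>\<i>)\<close> and eigenvalues
\<open>a \<mp> \<i> * b\<close>, so it stretches every nonzero vector by more than \<open>r\<close> as soon as \<open>r\<close> lies below
both of their moduli.\<close>
lemma norm_rotation_less:
  fixes a b y z :: complex
  assumes r: "r \<ge> 0" and "r < norm (a + \<i> * b)" "r < norm (a - \<i> * b)" and yz: "y \<noteq> 0 \<or> z \<noteq> 0"
  shows "r\<^sup>2 * ((norm y)\<^sup>2 + (norm z)\<^sup>2) < (norm (a * y - b * z))\<^sup>2 + (norm (a * z + b * y))\<^sup>2"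
proof -
  have par: "(norm (p + \<i> * q))\<^sup>2 + (norm (p - \<i> * q))\<^sup>2 = 2 * ((norm p)\<^sup>2 + (norm q)\<^sup>2)" for p q
    unfolding cmod_power2 by (simp add: power2_eq_square algebra_simps)
  have le: "r\<^sup>2 * (norm w)\<^sup>2 \<le> (norm (v * w))\<^sup>2"
    and less: "w \<noteq> 0 \<Longrightarrow> r\<^sup>2 * (norm w)\<^sup>2 < (norm (v * w))\<^sup>2"
    if "r < norm v" for v w :: complex
  proof -
    have "r\<^sup>2 < (norm v)\<^sup>2" using that r by (intro power_strict_mono) auto
    thus "r\<^sup>2 * (norm w)\<^sup>2 \<le> (norm (v * w))\<^sup>2" "w \<noteq> 0 \<Longrightarrow> r\<^sup>2 * (norm w)\<^sup>2 < (norm (v * w))\<^sup>2"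
      by (auto simp: norm_mult power_mult_distrib intro!: mult_right_mono)
  qed
  have "y + \<i> * z \<noteq> 0 \<or> y - \<i> * z \<noteq> 0"
    using yz by (auto simp: complex_eq_iff)
  hence "r\<^sup>2 * (norm (y + \<i> * z))\<^sup>2 + r\<^sup>2 * (norm (y - \<i> * z))\<^sup>2
      < (norm ((a + \<i> * b) * (y + \<i> * z)))\<^sup>2 + (norm ((a - \<i> * b) * (y - \<i> * z)))\<^sup>2"
    using le less assms(2,3) by (meson add_le_less_mono add_less_le_mono)
  also have "(a + \<i> * b) * (y + \<i> * z) = (a * y - b * z) + \<i> * (a * z + b * y)"
    by (simp add: algebra_simps)
  also have "(a - \<i> * b) * (y - \<i> * z) = (a * y - b * z) - \<i> * (a * z + b * y)"
    by (simp add: algebra_simps)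
  finally have "r\<^sup>2 * (norm (y + \<i> * z))\<^sup>2 + r\<^sup>2 * (norm (y - \<i> * z))\<^sup>2
      < 2 * ((norm (a * y - b * z))\<^sup>2 + (norm (a * z + b * y))\<^sup>2)"
    by (simp only: par)
  hence "r\<^sup>2 * ((norm (y + \<i> * z))\<^sup>2 + (norm (y - \<i> * z))\<^sup>2)
      < 2 * ((norm (a * y - b * z))\<^sup>2 + (norm (a * z + b * y))\<^sup>2)"
    by (simp only: distrib_left)
  thus ?thesis
    by (simp only: par mult.left_commute[of "r\<^sup>2" 2] mult_less_cancel_left_pos zero_less_numeral)
qed

text \<open>Write \<open>T k\<close> for the factor of \<open>\<mu>\<close>. If \<open>T k * \<mu>\<close> were farther than \<open>N\<close> from both \<open>\<i> * N\<^sup>2\<close> and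
\<open>-\<i> * N\<^sup>2\<close> at every frequency, then, pairing \<open>k\<close> with \<open>-k\<close>, the operator
\<open>Y \<mapsto> (T k * \<mu> * Y k - N\<^sup>2 * Y (-k))\<^sub>k\<close> would stretch every nonzero \<open>Y\<close> by more than \<open>N\<close>. On the transform of an eigenvector it yields \<open>N * Y (-2 * k)\<close>, a permutation of \<open>Y\<close>
scaled by exactly \<open>N\<close>.\<close>
lemma eigenvalue_near_frequency:
  fixes x :: "int \<Rightarrow> complex"
  assumes N: "N > 0" and h: "2 * h = N + 1"
    and l: "l \<in> {0..<N}" "x l \<noteq> 0"
    and sum0: "(\<Sum>j\<in>{0..<N}. x j) = 0"
    and eig: "\<And>i. i \<in> {0..<N} \<Longrightarrow>
      (\<Sum>j\<in>{0..<N}. of_int (N * ((i + j + h) mod N) + (i + 2 * j + 1) mod N + 1) * x j) = \<mu> * x i"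
  shows "\<exists>k\<in>{0..<N}. \<exists>\<epsilon>\<in>{1, -1 :: int}.
     norm ((unity N (k * h) - unity N (- (k * h))) * \<mu> - \<i> * of_int \<epsilon> * of_int N ^ 2) \<le> of_int N"
proof -
  define T where "T = (\<lambda>k. unity N (k * h) - unity N (- (k * h)))"
  define Y where "Y = shifted_dft N h x"
  define G where "G = (\<lambda>k. (norm (T k * \<mu> * Y k - of_int N ^ 2 * Y (- k)))\<^sup>2)"
  define S where "S = (\<Sum>k\<in>{0..<N}. (norm (Y k))\<^sup>2)"
  have Tper: "T (k mod N) = T k" for k
    using unity_periodic[OF N, of h k 0] unity_periodic[OF N, of "- h" k 0]
    by (simp add: T_def mult_ac)
  have Yper: "Y (u * (k mod N)) = Y (u * k)" for u k
    unfolding Y_def by (rule shifted_dft_periodic[OF N])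
  note Yper1 = Yper[of 1, simplified]
  note Yperm = Yper[of "-1", simplified]
  have coprime2: "coprime 2 N"
  proof -
    have "odd N" using h by presburger
    thus ?thesis by simp
  qed
  have Ysum: "(\<Sum>k\<in>{0..<N}. (norm (Y (u * k)))\<^sup>2) = S" if "coprime u N" for u
    using sum_affine_residues[OF N that, of "\<lambda>k. (norm (Y k))\<^sup>2" 0] by (simp add: Yper1 S_def)
  have "G k = of_int N ^ 2 * (norm (Y (- 2 * k)))\<^sup>2" for k
    using shifted_dft_eigenvector[OF N h sum0 eig, of k] N
    by (simp add: G_def T_def Y_def norm_mult power_mult_distrib del: mult_minus_left)
  hence "(\<Sum>k\<in>{0..<N}. G k) = of_int N ^ 2 * S"
    using Ysum[of "-2"] coprime2 by (simp flip: sum_distrib_left)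
  moreover have "(\<Sum>k\<in>{0..<N}. G (- k)) = (\<Sum>k\<in>{0..<N}. G k)"
    using sum_affine_residues[OF N, of "-1" G 0] by (simp add: G_def Tper Yper1 Yperm)
  ultimately have total: "(\<Sum>k\<in>{0..<N}. G k + G (- k)) =
      (\<Sum>k\<in>{0..<N}. of_int N ^ 2 * ((norm (Y k))\<^sup>2 + (norm (Y (- k)))\<^sup>2))"
    using Ysum[of "-1"] by (simp add: sum.distrib S_def flip: sum_distrib_left)
  show ?thesis
  proof (rule ccontr)
    assume contra: "\<not> ?thesis"
    hence far: "of_int N < norm (T k * \<mu> + \<i> * of_int N ^ 2)"
        "of_int N < norm (T k * \<mu> - \<i> * of_int N ^ 2)" if "k \<in> {0..<N}" for k
      using that contra unfolding T_def by force+
    \<comment> \<open>\<open>T\<close> is odd, so the frequencies \<open>k\<close> and \<open>-k\<close> form a two-dimensional rotation block.\<close>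
    have strict: "of_int N ^ 2 * ((norm (Y k))\<^sup>2 + (norm (Y (- k)))\<^sup>2) < G k + G (- k)"
      if k: "k \<in> {0..<N}" "Y k \<noteq> 0 \<or> Y (- k) \<noteq> 0" for k
    proof -
      have "G (- k) = (norm (T k * \<mu> * Y (- k) + of_int N ^ 2 * Y k))\<^sup>2"
      proof -
        have "T (- k) * \<mu> * Y (- k) - of_int N ^ 2 * Y k = - (T k * \<mu> * Y (- k) + of_int N ^ 2 * Y k)"
          by (simp add: T_def algebra_simps)
        thus ?thesis unfolding G_def minus_minus by (metis norm_minus_cancel)
      qed
      thus ?thesis
        using norm_rotation_less[OF _ far[OF k(1)] k(2)] N by (simp add: G_def)
    qed
    have le: "of_int N ^ 2 * ((norm (Y k))\<^sup>2 + (norm (Y (- k)))\<^sup>2) \<le> G k + G (- k)"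
      if "k \<in> {0..<N}" for k
      using strict[OF that] by (cases "Y k \<noteq> 0 \<or> Y (- k) \<noteq> 0") (auto simp: G_def)
    obtain k where "k \<in> {0..<N}" "Y k \<noteq> 0"
      using shifted_dft_nonzero[of N l x h] N l by (auto simp: Y_def)
    hence "(\<Sum>k\<in>{0..<N}. of_int N ^ 2 * ((norm (Y k))\<^sup>2 + (norm (Y (- k)))\<^sup>2)) < (\<Sum>k\<in>{0..<N}. G k + G (- k))"
      using le strict by (intro sum_strict_mono_ex1) blast+
    thus False using total by simp
  qed
qed

section \<open>The Siamese magic square\<close>

lemma siamese_index:
  assumes "n = 2 * m + 1" "i < n" "j < n"
  shows "siamese n $$ (i, j) = of_int (int n * ((int i + int j + (int m + 1)) mod int n)
           + (int i + 2 * int j + 1) mod int n + 1)"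
proof -
  have half: "(int n - 3) div 2 = int m - 1" using assms(1) by simp
  have "int i + 1 + (int j + 1) + (int m - 1) = int i + int j + (int m + 1)"
    "int i + 1 + 2 * (int j + 1) - 2 = int i + 2 * int j + 1" by simp_all
  thus ?thesis using assms(2,3) by (simp only: siamese_def siamese_entry_def index_mat split half)
qed

text \<open>Each column runs through all residues in both digits.\<close>
lemma siamese_column_sum:
  assumes n: "n = 2 * m + 1" and j: "j < n"
  shows "(\<Sum>i<n. siamese n $$ (i, j)) = magic_sum n"
proof -
  let ?N = "int n"
  have N: "?N > 0" using n by simp
  have shift: "(\<Sum>i\<in>{0..<?N}. (i + c) mod ?N) = (\<Sum>i\<in>{0..<?N}. i)" for c
  proof -
    have "(\<Sum>i\<in>{0..<?N}. (1 * i + c) mod ?N) = (\<Sum>i\<in>{0..<?N}. i mod ?N)"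
      by (intro sum_affine_residues[OF N]) auto
    also have "\<dots> = (\<Sum>i\<in>{0..<?N}. i)" by (intro sum.cong) auto
    finally show ?thesis by simp
  qed
  have "(\<Sum>i\<in>{0..<?N}. i) = (\<Sum>i<n. int i)"
    by (simp add: sum.atLeast_int_lessThan_int_shift[of _ 0 n, simplified] lessThan_atLeast0)
  also have "2 * \<dots> = ?N * (?N - 1)"
    by (induction n) (auto simp: algebra_simps)
  finally have gauss: "2 * (\<Sum>i\<in>{0..<?N}. i) = ?N * (?N - 1)" .
  have "(\<Sum>i<n. siamese n $$ (i, j)) = of_int (\<Sum>i<n. ?N * ((int i + int j + (int m + 1)) mod ?N)
           + (int i + 2 * int j + 1) mod ?N + 1)"
    unfolding of_int_sum using siamese_index[OF n _ j] by (intro sum.cong) auto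
  also have "(\<Sum>i<n. ?N * ((int i + int j + (int m + 1)) mod ?N) + (int i + 2 * int j + 1) mod ?N + 1)
    = (\<Sum>i\<in>{0..<?N}. ?N * ((i + (int j + (int m + 1))) mod ?N) + (i + (2 * int j + 1)) mod ?N + 1)"
    by (simp add: sum.atLeast_int_lessThan_int_shift[of _ 0 n, simplified] lessThan_atLeast0 o_def add.assoc)
  also have "\<dots> = ?N * (\<Sum>i\<in>{0..<?N}. i) + (\<Sum>i\<in>{0..<?N}. i) + ?N"
    by (simp add: sum.distrib shift flip: sum_distrib_left)
  finally have *: "(\<Sum>i<n. siamese n $$ (i, j)) = of_int (?N * (\<Sum>i\<in>{0..<?N}. i) + (\<Sum>i\<in>{0..<?N}. i) + ?N)" .
  have "2 * (?N * (\<Sum>i\<in>{0..<?N}. i) + (\<Sum>i\<in>{0..<?N}. i) + ?N) = (?N + 1) * (2 * (\<Sum>i\<in>{0..<?N}. i)) + 2 * ?N"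
    by (simp add: algebra_simps)
  also have "\<dots> = ?N * (?N ^ 2 + 1)" unfolding gauss by (simp add: algebra_simps power2_eq_square)
  finally have "2 * (\<Sum>i<n. siamese n $$ (i, j)) = of_int (?N * (?N ^ 2 + 1))"
    unfolding * by (metis of_int_mult of_int_numeral)
  thus ?thesis by (simp add: magic_sum_def mult.commute)
qed

lemma unity_diff:
  "unity N k - unity N (- k) = \<i> * complex_of_real (2 * sin (2 * pi * of_int k / of_int N))"
  by (simp add: unity_def complex_eq_iff)

text \<open>The relative error bound with denominators cleared: dividing by
\<open>s = 2 * sin (k * pi / n)\<close>, for \<open>k\<close> not 0, gives distance at most \<open>n / s\<close> from \<open>\<plusminus>n\<^sup>2 / s\<close>.\<close>
lemma nontrivial_eigenvalue_near_frequency: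
  assumes n: "n = 2 * m + 1" and mu: "\<mu> \<in># nontrivial_eigenvalues n"
  shows "\<exists>k\<in>{0..<int n}. \<exists>\<delta>\<in>{1, -1 :: int}.
    norm (complex_of_real (2 * sin (of_int k * pi / real n)) * \<mu> - of_int \<delta> * of_nat n ^ 2) \<le> real n"
proof -
  let ?N = "int n" and ?h = "int m + 1"
  have A: "siamese n \<in> carrier_mat n n" by (simp add: siamese_def)
  have "\<exists>x. (\<Sum>j<n. x j) = 0 \<and> (\<exists>j<n. x j \<noteq> 0) \<and>
    (\<forall>i<n. (\<Sum>j<n. siamese n $$ (i, j) * x j) = \<mu> * x i)"
  proof (rule eigenvector_of_complementary_root[OF A _ siamese_column_sum[OF n]])
    show "n > 0" using n by simp
    show "\<mu> \<in># proots (char_poly (siamese n)) - {#magic_sum n#}"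
      using mu by (simp add: nontrivial_eigenvalues_def)
  qed
  then obtain x where x: "(\<Sum>j<n. x j) = 0" "\<exists>j<n. x j \<noteq> 0"
    "\<And>i. i < n \<Longrightarrow> (\<Sum>j<n. siamese n $$ (i, j) * x j) = \<mu> * x i"
    by blast
  define y where "y = (\<lambda>k. x (nat k))"
  have int_sum: "(\<Sum>j\<in>{0..<?N}. f j) = (\<Sum>j<n. f (int j))" for f :: "int \<Rightarrow> complex"
    by (simp add: sum.atLeast_int_lessThan_int_shift[of _ 0 n, simplified] lessThan_atLeast0 o_def)
  obtain l where l: "l < n" "x l \<noteq> 0" using x(2) by blast
  have eig: "(\<Sum>j\<in>{0..<?N}. of_int (?N * ((i + j + ?h) mod ?N) + (i + 2 * j + 1) mod ?N + 1) * y j)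
      = \<mu> * y i" if "i \<in> {0..<?N}" for i
  proof -
    define i' where "i' = nat i"
    have i': "i = int i'" "i' < n"
      using that by (auto simp: i'_def)
    show ?thesis
      unfolding int_sum i'(1) y_def nat_int x(3)[OF i'(2), symmetric]
      using siamese_index[OF n i'(2)] by (intro sum.cong) auto
  qed
  have "\<exists>k\<in>{0..<?N}. \<exists>\<epsilon>\<in>{1, -1 :: int}.
    norm ((unity ?N (k * ?h) - unity ?N (- (k * ?h))) * \<mu> - \<i> * of_int \<epsilon> * of_int ?N ^ 2) \<le> of_int ?N"
  proof (rule eigenvalue_near_frequency[where x = y and l = "int l"])
    show "?N > 0" "2 * ?h = ?N + 1" using n by simp_all
    show "int l \<in> {0..<?N}" "y (int l) \<noteq> 0" using l by (simp_all add: y_def)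
    show "(\<Sum>j\<in>{0..<?N}. y j) = 0" unfolding int_sum using x(1) by (simp add: y_def)
  qed (rule eig)
  then obtain k and \<epsilon> :: int where k: "k \<in> {0..<?N}" and \<epsilon>: "\<epsilon> \<in> {1, -1}" and
    near: "norm ((unity ?N (k * ?h) - unity ?N (- (k * ?h))) * \<mu> - \<i> * of_int \<epsilon> * of_int ?N ^ 2) \<le> of_int ?N"
    by blast
  \<comment> \<open>As \<open>2 * (m + 1) = n + 1\<close>, the angle is \<open>k * pi / n\<close> up to a multiple of \<open>pi\<close>, which only
      costs a sign.\<close>
  have "2 * pi * of_int (k * ?h) / of_int ?N = of_int k * pi / real n + of_int k * pi"
    using n by (simp add: field_simps)
  moreover define \<tau> :: int where "\<tau> = (if even k then 1 else -1)"
  moreover have "sin (u + of_int k * pi) = of_int \<tau> * sin u" for u :: real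
    using cos_npi_int[of k] sin_npi_int[of k] by (simp add: \<tau>_def sin_add mult.commute)
  ultimately have \<tau>: "\<tau> \<in> {1, -1}"
    "sin (2 * pi * of_int (k * ?h) / of_int ?N) = of_int \<tau> * sin (of_int k * pi / real n)"
    by simp_all
  have "(unity ?N (k * ?h) - unity ?N (- (k * ?h))) * \<mu> - \<i> * of_int \<epsilon> * of_int ?N ^ 2
    = \<i> * of_int \<tau> * (complex_of_real (2 * sin (of_int k * pi / real n)) * \<mu> - of_int (\<tau> * \<epsilon>) * of_nat n ^ 2)"
    unfolding unity_diff \<tau>(2) using \<tau>(1) by (auto simp: algebra_simps)
  hence "norm (complex_of_real (2 * sin (of_int k * pi / real n)) * \<mu> - of_int (\<tau> * \<epsilon>) * of_nat n ^ 2) \<le> real n"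
    using near \<tau>(1) by (auto simp: norm_mult)
  moreover have "\<tau> * \<epsilon> \<in> {1, -1}" using \<tau>(1) \<epsilon> by auto
  ultimately show ?thesis using k by blast
qed

theorem theorem3p1:
  fixes m n :: nat
  assumes "m \<ge> 1" and "n = 2 * m + 1"
  shows "approximated_by (1 / real n)
    (set_mset (nontrivial_eigenvalues n))
    {complex_of_real ((real n)\<^sup>2 / (2 * sin (real_of_int j * pi / real n))) | j :: int.
       1 \<le> \<bar>j\<bar> \<and> \<bar>j\<bar> \<le> int m}"
  unfolding approximated_by_def
proof
  fix \<mu> assume "\<mu> \<in># nontrivial_eigenvalues n"
  then obtain k \<delta> where k: "k \<in> {0..<int n}" and \<delta>: "\<delta> \<in> {1, -1 :: int}" and
    near: "norm (complex_of_real (2 * sin (of_int k * pi / real n)) * \<mu> - of_int \<delta> * of_nat n ^ 2) \<le> real n"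
    using nontrivial_eigenvalue_near_frequency[OF assms(2)] by blast
  have n: "n \<ge> 3" using assms by simp
  define s where "s = 2 * sin (of_int k * pi / real n)"
  \<comment> \<open>At frequency 0 the bound would read \<open>n\<^sup>2 \<le> n\<close>.\<close>
  have "k \<noteq> 0"
  proof
    assume "k = 0"
    hence "real n ^ 2 \<le> real n" using near \<delta> by (auto simp: norm_power)
    hence "real n * real n \<le> real n * 1" by (simp add: power2_eq_square)
    thus False using n by (subst (asm) mult_le_cancel_left_pos) auto
  qed
  hence s: "s > 0"
    using k n unfolding s_def by (auto intro!: mult_pos_pos sin_gt_zero simp: field_simps)
  \<comment> \<open>Reflect \<open>k\<close> into \<open>{1..m}\<close>, which keeps the sine, and carry the sign in the index.\<close>
  define j where "j = \<delta> * (if k \<le> int m then k else int n - k)"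
  have "sin ((real n - of_int k) * pi / real n) = sin (of_int k * pi / real n)"
    using n sin_pi_minus[of "of_int k * pi / real n"] by (simp add: field_simps)
  moreover have "real_of_int j * pi / real n
      = of_int \<delta> * ((if k \<le> int m then of_int k else real n - of_int k) * pi / real n)"
    by (simp add: j_def)
  moreover have "sin (of_int \<delta> * u) = of_int \<delta> * sin u" for u :: real
    using \<delta> by auto
  ultimately have sin_j: "2 * sin (of_int j * pi / real n) = of_int \<delta> * s"
    by (cases "k \<le> int m") (simp_all only: s_def if_True if_False mult.left_commute)
  define q where "q = complex_of_real ((real n)\<^sup>2 / (2 * sin (real_of_int j * pi / real n)))"
  have q: "q = of_int \<delta> * of_nat n ^ 2 / of_real s"
    using \<delta> by (auto simp: q_def sin_j)
  have norm_q: "norm q = real n ^ 2 / s"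
    using \<delta> s by (auto simp: q norm_divide norm_mult norm_power)
  have "norm (\<mu> - q) \<le> real n / s"
  proof -
    have "\<mu> - q = (of_real s * \<mu> - of_int \<delta> * of_nat n ^ 2) / of_real s"
      using s by (simp add: q field_simps)
    hence "norm (\<mu> - q) = norm (of_real s * \<mu> - of_int \<delta> * of_nat n ^ 2) / s"
      using s by (simp add: norm_divide)
    thus ?thesis using near s by (simp add: s_def divide_right_mono)
  qed
  hence "norm (\<mu> - q) / norm q \<le> (real n / s) / (real n ^ 2 / s)"
    unfolding norm_q using s by (intro divide_right_mono) auto
  also have "\<dots> = 1 / real n"
    using s n by (simp add: power2_eq_square)
  finally have "q \<noteq> 0 \<and> norm (\<mu> - q) / norm q \<le> 1 / real n"
    using norm_q s n by auto
  moreover have "1 \<le> \<bar>j\<bar> \<and> \<bar>j\<bar> \<le> int m"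
    using \<delta> k \<open>k \<noteq> 0\<close> assms(2) by (auto simp: j_def)
  ultimately show "\<exists>q\<in>{complex_of_real ((real n)\<^sup>2 / (2 * sin (real_of_int j * pi / real n))) | j :: int.
       1 \<le> \<bar>j\<bar> \<and> \<bar>j\<bar> \<le> int m}. q \<noteq> 0 \<and> norm (\<mu> - q) / norm q \<le> 1 / real n"
    unfolding q_def by blast
qed

end
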